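(* Let $m\ge3$ be even and $n\ge2$. Then the set $\mathbb{H}_1=\{\mathcal{A}\in\mathbb{S}_{m,n} : \mathcal{A}-N(\mathcal{A})\in\mathbb{PSD}\}$ is convex and satisfies $\mathbb{N}^+_{m,n}\subseteq\mathbb{H}_1\subseteq\mathbb{COP}_{m,n}$.
   Context: $\mathbb{S}_{m,n}$ is the set of real symmetric tensors of order $m$ and dimension $n$. For $\mathcal{A}=(a_{i_1\cdots i_m})\in\mathbb{S}_{m,n}$, $N(\mathcal{A})$ is the tensor with $N(\mathcal{A})_{i_1\cdots i_m}=a_{i_1\cdots i_m}$ if $a_{i_1\cdots i_m}>0$ and not all of $i_1,\dots,i_m$ are equal, and $N(\mathcal{A})_{i_1\cdots i_m}=0$ otherwise. $\mathbb{PSD}$ is the set of (even order) symmetric tensors $\mathcal{T}$ with $\mathcal{T}\mathbf{x}^m=\sum t_{i_1\cdots i_m}x_{i_1}\cdots x_{i_m}\ge0$ for all $\mathbf{x}\in\mathbb{R}^n$. $\mathbb{N}^+_{m,n}$ is the set of entrywise nonnegative tensors in $\mathbb{S}_{m,n}$, and $\mathbb{COP}_{m,n}$ is the set of copositive tensors in $\mathbb{S}_{m,n}$, i.e. those with $\mathcal{A}\mathbf{x}^m\ge0$ for all $\mathbf{x}\in\mathbb{R}^n_+$. *)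

theory Defs
  imports "HOL-Analysis.Analysis"
begin

text \<open>
  A real tensor of order $m$ and dimension $n$ is an element of
  \<^typ>\<open>real ^ ('m::finite \<Rightarrow> 'n::finite)\<close> with $m$ = \<open>CARD('m)\<close> and $n$ = \<open>CARD('n)\<close>:
  a multi-index $(i_1, \dots, i_m)$ is a function \<open>i :: 'm \<Rightarrow> 'n\<close>, and the entry at it is
  \<open>A $ i\<close>. The vector-space structure, and hence \<^const>\<open>convex\<close>, is the entrywise one.
\<close>

type_synonym ('m, 'n) tensor = "real ^ ('m \<Rightarrow> 'n)"

definition sym_tensors :: "('m::finite, 'n::finite) tensor set" where
  "sym_tensors = {A. \<forall>p i. bij p \<longrightarrow> A $ (i \<circ> p) = A $ i}"

text \<open>The homogeneous form $\mathcal{T}\mathbf{x}^m$.\<close>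

definition tensor_form :: "('m::finite, 'n::finite) tensor \<Rightarrow> real ^ 'n \<Rightarrow> real" where
  "tensor_form T x = (\<Sum>i\<in>UNIV. T $ i * (\<Prod>k\<in>UNIV. x $ (i k)))"

definition pos_offdiag :: "('m::finite, 'n::finite) tensor \<Rightarrow> ('m, 'n) tensor" where
  "pos_offdiag A =
     (\<chi> i. if A $ i > 0 \<and> \<not> (\<forall>k l. i k = i l) then A $ i else 0)"

definition psd_tensors :: "('m::finite, 'n::finite) tensor set" where
  "psd_tensors = {T \<in> sym_tensors. even CARD('m) \<and> (\<forall>x. tensor_form T x \<ge> 0)}"

definition nonneg_tensors :: "('m::finite, 'n::finite) tensor set" where
  "nonneg_tensors = {A \<in> sym_tensors. \<forall>i. A $ i \<ge> 0}"

definition copositive_tensors :: "('m::finite, 'n::finite) tensor set" where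
  "copositive_tensors =
     {A \<in> sym_tensors. \<forall>x. (\<forall>j. x $ j \<ge> 0) \<longrightarrow> tensor_form A x \<ge> 0}"

definition H1 :: "('m::finite, 'n::finite) tensor set" where
  "H1 = {A \<in> sym_tensors. A - pos_offdiag A \<in> psd_tensors}"

end

theory Submission
  imports Defs
begin

text \<open>
  Subtracting \<open>N(A)\<close> keeps the diagonal of \<open>A\<close> and truncates the off-diagonal entries to their
  negative parts, so \<open>A \<mapsto> A - N(A)\<close> is entrywise concave. In even order, a form with nonpositive
  off-diagonal entries does not increase when \<open>x\<close> is replaced by \<open>\<bar>x\<bar>\<close>; it is therefore positive
  semidefinite as soon as it is nonnegative on the nonnegative orthant, where forms are monotone
  in their coefficients. Convexity follows by combining these two facts.
\<close>

text \<open>Writing the truncation as a \<open>min\<close> exposes both its sign off the diagonal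
  and its concavity.\<close>

lemma minus_pos_offdiag_nth:
  "(A - pos_offdiag A) $ i = (if \<forall>k l. i k = i l then A $ i else min (A $ i) 0)"
  by (auto simp: pos_offdiag_def)

lemma sym_tensors_lincomb:
  assumes "A \<in> sym_tensors" "B \<in> sym_tensors"
  shows "u *\<^sub>R A + v *\<^sub>R B \<in> sym_tensors"
  using assms by (simp add: sym_tensors_def)

lemma pos_offdiag_sym:
  assumes "A \<in> sym_tensors"
  shows "pos_offdiag A \<in> sym_tensors"
proof -
  have "pos_offdiag A $ (i \<circ> p) = pos_offdiag A $ i" if p: "bij p" for p i
  proof -
    \<comment> \<open>Since \<open>p\<close> is surjective, \<open>i \<circ> p\<close> and
      \<open>i\<close> have the same range, so one is constant exactly when the other is.\<close>
    have "(\<forall>k l. i (p k) = i (p l)) \<longleftrightarrow> (\<forall>k l. i k = i l)"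
      using bij_is_surj[OF p] by (metis surjD)
    moreover have "A $ (i \<circ> p) = A $ i"
      using assms p by (simp add: sym_tensors_def)
    ultimately show ?thesis
      unfolding pos_offdiag_def vec_lambda_beta comp_apply by presburger
  qed
  then show ?thesis
    by (simp add: sym_tensors_def)
qed

lemma minus_pos_offdiag_sym:
  assumes "A \<in> sym_tensors"
  shows "A - pos_offdiag A \<in> sym_tensors"
  using sym_tensors_lincomb[OF assms pos_offdiag_sym[OF assms], of 1 "- 1"] by simp

lemma tensor_form_lincomb:
  "tensor_form (u *\<^sub>R A + v *\<^sub>R B) x = u * tensor_form A x + v * tensor_form B x"
  by (simp add: tensor_form_def sum_distrib_left distrib_right sum.distrib mult.assoc)

lemma tensor_form_mono:
  assumes "\<And>i. A $ i \<le> B $ i" "\<And>j. x $ j \<ge> 0"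
  shows "tensor_form A x \<le> tensor_form B x"
  unfolding tensor_form_def
  by (intro sum_mono mult_right_mono prod_nonneg) (auto simp: assms)

text \<open>The comparison is termwise. A diagonal monomial is an even power, unchanged by absolute
  values; any other monomial can only grow, and its coefficient is nonpositive.\<close>

lemma tensor_form_abs_le:
  fixes T :: "('m::finite, 'n::finite) tensor"
  assumes "even CARD('m)" and off: "\<And>i. \<not> (\<forall>k l. i k = i l) \<Longrightarrow> T $ i \<le> 0"
  shows "tensor_form T (\<chi> j. \<bar>x $ j\<bar>) \<le> tensor_form T x"
  unfolding tensor_form_def
proof (rule sum_mono)
  fix i :: "'m \<Rightarrow> 'n"
  show "T $ i * (\<Prod>k\<in>UNIV. (\<chi> j. \<bar>x $ j\<bar>) $ i k) \<le> T $ i * (\<Prod>k\<in>UNIV. x $ i k)"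
  proof (cases "\<forall>k l. i k = i l")
    case True
    then obtain c where "i = (\<lambda>k. c)"
      by (meson ext)
    then show ?thesis
      using assms(1) by (simp add: power_even_abs)
  next
    case False
    have "(\<Prod>k\<in>UNIV. x $ i k) \<le> \<bar>\<Prod>k\<in>UNIV. x $ i k\<bar>"
      by (rule abs_ge_self)
    then show ?thesis
      using off[OF False] by (simp add: abs_prod mult_left_mono_neg)
  qed
qed

lemma tensor_form_nonneg_from_orthant:
  fixes T :: "('m::finite, 'n::finite) tensor"
  assumes "even CARD('m)" "\<And>i. \<not> (\<forall>k l. i k = i l) \<Longrightarrow> T $ i \<le> 0"
    and "\<And>y. (\<And>j. y $ j \<ge> 0) \<Longrightarrow> tensor_form T y \<ge> 0"
  shows "tensor_form T x \<ge> 0"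
proof -
  have "0 \<le> tensor_form T (\<chi> j. \<bar>x $ j\<bar>)"
    by (rule assms(3)) simp
  then show ?thesis
    using tensor_form_abs_le[OF assms(1,2), of x] by simp
qed

lemma H1_iff_orthant:
  fixes A :: "('m::finite, 'n::finite) tensor"
  assumes "even CARD('m)"
  shows "A \<in> H1 \<longleftrightarrow> A \<in> sym_tensors \<and>
    (\<forall>x. (\<forall>j. x $ j \<ge> 0) \<longrightarrow> tensor_form (A - pos_offdiag A) x \<ge> 0)"
proof -
  have "tensor_form (A - pos_offdiag A) x \<ge> 0"
    if "\<forall>y. (\<forall>j. y $ j \<ge> 0) \<longrightarrow> tensor_form (A - pos_offdiag A) y \<ge> 0" for x
    \<comment> \<open>The simp rule \<open>vector_minus_component\<close> is removed because it
      would split the difference before \<open>minus_pos_offdiag_nth\<close> can match.\<close>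
    by (rule tensor_form_nonneg_from_orthant[OF assms])
      (use that in \<open>auto simp: minus_pos_offdiag_nth simp del: vector_minus_component\<close>)
  then show ?thesis
    using assms minus_pos_offdiag_sym by (auto simp: H1_def psd_tensors_def)
qed

text \<open>Diagonal entries are linear in the tensor; off the diagonal this is concavity of
  \<open>min t 0\<close> in \<open>t\<close>.\<close>

lemma minus_pos_offdiag_concave:
  assumes "u \<ge> 0" "v \<ge> 0"
  shows "(u *\<^sub>R (A - pos_offdiag A) + v *\<^sub>R (B - pos_offdiag B)) $ i
    \<le> (u *\<^sub>R A + v *\<^sub>R B - pos_offdiag (u *\<^sub>R A + v *\<^sub>R B)) $ i"
proof -
  have "u * min (A $ i) 0 + v * min (B $ i) 0 \<le> min (u * A $ i + v * B $ i) 0"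
    using assms by (intro min.boundedI add_mono mult_left_mono add_nonpos_nonpos mult_nonneg_nonpos) auto
  then show ?thesis
    unfolding minus_pos_offdiag_nth vector_add_component vector_scaleR_component by simp
qed

lemma convex_H1:
  assumes "even CARD('m)"
  shows "convex (H1 :: ('m::finite, 'n::finite) tensor set)"
proof (rule convexI)
  fix A B :: "('m, 'n) tensor" and u v :: real
  assume A: "A \<in> H1" and B: "B \<in> H1" and uv: "0 \<le> u" "0 \<le> v"
  \<comment> \<open>By \<open>H1_iff_orthant\<close> it suffices to test nonnegative
    \<open>x\<close>, where the entrywise bound passes to the forms.\<close>
  have "0 \<le> tensor_form (u *\<^sub>R A + v *\<^sub>R B - pos_offdiag (u *\<^sub>R A + v *\<^sub>R B)) x"
    if x: "\<forall>j. x $ j \<ge> 0" for x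
  proof -
    have "0 \<le> tensor_form (u *\<^sub>R (A - pos_offdiag A) + v *\<^sub>R (B - pos_offdiag B)) x"
      unfolding tensor_form_lincomb
      using A B uv by (simp add: H1_def psd_tensors_def)
    also have "\<dots> \<le> tensor_form (u *\<^sub>R A + v *\<^sub>R B - pos_offdiag (u *\<^sub>R A + v *\<^sub>R B)) x"
      using x by (intro tensor_form_mono minus_pos_offdiag_concave uv) auto
    finally show ?thesis .
  qed
  then show "u *\<^sub>R A + v *\<^sub>R B \<in> H1"
    using A B H1_iff_orthant[OF assms] sym_tensors_lincomb by blast
qed

lemma nonneg_tensors_subset_H1:
  assumes "even CARD('m)"
  shows "(nonneg_tensors :: ('m::finite, 'n::finite) tensor set) \<subseteq> H1"
proof
  fix A :: "('m, 'n) tensor"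
  assume A: "A \<in> nonneg_tensors"
  then have nonneg: "0 \<le> (A - pos_offdiag A) $ i" for i
    unfolding minus_pos_offdiag_nth by (simp add: nonneg_tensors_def)
  \<comment> \<open>The form of the zero tensor vanishes, so monotonicity yields nonnegativity on
    the orthant.\<close>
  have "tensor_form (0 :: ('m, 'n) tensor) x \<le> tensor_form (A - pos_offdiag A) x"
    if "\<forall>j. x $ j \<ge> 0" for x
    by (rule tensor_form_mono) (use nonneg that in auto)
  then show "A \<in> H1"
    using A H1_iff_orthant[OF assms] by (auto simp: nonneg_tensors_def tensor_form_def)
qed

text \<open>\<open>pos_offdiag A\<close> has nonnegative entries, so adding it back to a positive
  semidefinite tensor can only raise the form on the orthant.\<close>

lemma H1_subset_copositive_tensors:
  "(H1 :: ('m::finite, 'n::finite) tensor set) \<subseteq> copositive_tensors"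
proof
  fix A :: "('m, 'n) tensor"
  assume A: "A \<in> H1"
  have "0 \<le> tensor_form A x" if x: "\<forall>j. x $ j \<ge> 0" for x
  proof -
    have "0 \<le> tensor_form (A - pos_offdiag A) x"
      using A by (simp add: H1_def psd_tensors_def)
    also have "\<dots> \<le> tensor_form A x"
      using x by (intro tensor_form_mono) (auto simp: pos_offdiag_def)
    finally show ?thesis .
  qed
  then show "A \<in> copositive_tensors"
    using A by (simp add: H1_def copositive_tensors_def)
qed

theorem theorem4p1:
  assumes "CARD('m::finite) \<ge> 3" and "even CARD('m)" and "CARD('n::finite) \<ge> 2"
  shows "convex (H1 :: ('m, 'n) tensor set)
    \<and> (nonneg_tensors :: ('m, 'n) tensor set) \<subseteq> H1
    \<and> (H1 :: ('m, 'n) tensor set) \<subseteq> copositive_tensors"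
  using convex_H1[OF assms(2)] nonneg_tensors_subset_H1[OF assms(2)]
    H1_subset_copositive_tensors by blast

end
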